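(* Let $m\ge 2$, $n=2m-1$, let $q$ be a prime power, and let $J\subseteq\{1,\dots,n\}$ be such that $m\in J$ and $J=J^{w_0}$, i.e. $J=\{n+1-j:j\in J\}$. Let $C$ be the set of all flags of type $J$ in $\mathrm{PG}(n,q)$ such that either (i) the $m$-dimensional space of the flag contains a given fixed point, or (ii) the $m$-dimensional space of the flag is contained in a given fixed hyperplane (i.e. $C$ is defined by one of the two conditions). Then $C$ is an EKR-set of flags of type $J$ and $|C|=\dfrac{v}{1+q^{(n+1)/2}}$, where $v$ is the total number of flags of type $J$ in $\mathrm{PG}(n,q)$.
   Context: Let $V=\mathbb{F}_q^{n+1}$ with standard basis $e_1,\dots,e_{n+1}$; $\mathrm{PG}(n,q)$ is the geometry of subspaces of $V$, and dimension always means vector space dimension (points are $1$-dimensional, hyperplanes $n$-dimensional). A flag is a set of pairwise incident (comparable by inclusion) proper nonzero subspaces; its type is the set of dimensions of its members. Maximal flags have type $\{1,\dots,n\}$. Let $G=\mathrm{PGL}(n+1,q)$, $F=\{\langle e_1\rangle,\dots,\langle e_1,\dots,e_n\rangle\}$, and $B$ the stabilizer of $F$ in $G$. $\mathrm{Sym}(n+1)$ acts by $we_i=e_{w(i)}$, and $w_0=(1,n+1)(2,n)\cdots$ is its longest element with respect to the generators $s_i=(i,i+1)$; $w_0$ acts on types by $i\mapsto n+1-i$. Two maximal flags $gF,hF$ are opposite if $Bh^{-1}gB=Bw_0B$. Two flags of types $J$ and $K$ are opposite if $J^{w_0}=K$ and they can be extended to two opposite maximal flags. A set of flags of type $J=J^{w_0}$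 is an EKR-set if no two of its flags are opposite. *)

theory Defs
  imports "HOL-Analysis.Analysis" "HOL-Algebra.Group_Action"
begin

text \<open>
  The space \<open>V\<close> of dimension \<open>n + 1\<close> over the field of order \<open>q\<close> is the type
  \<open>'a ^ 'n\<close> with \<open>CARD('a) = q\<close> and \<open>CARD('n) = n + 1\<close>. The linear order on the index
  type serves only to number the standard basis vectors.
\<close>

type_synonym ('a, 'n) mat = "(('a, 'n) vec, 'n) vec"

definition std_basis :: "nat \<Rightarrow> ('a::field, 'n::{finite,linorder}) vec" where
  "std_basis i = axis (sorted_list_of_set (UNIV :: 'n set) ! (i - 1)) 1"

definition subspaces_of_dim :: "nat \<Rightarrow> ('a::field, 'n::finite) vec set set" where
  "subspaces_of_dim k = {U. vec.subspace U \<and> vec.dim U = k}"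

definition flag :: "('a::field, 'n::finite) vec set set \<Rightarrow> bool" where
  "flag f \<longleftrightarrow>
     (\<forall>U\<in>f. vec.subspace U \<and> U \<noteq> {0} \<and> U \<noteq> UNIV) \<and>
     (\<forall>U\<in>f. \<forall>W\<in>f. U \<subseteq> W \<or> W \<subseteq> U)"

definition flag_type :: "('a::field, 'n::finite) vec set set \<Rightarrow> nat set" where
  "flag_type f = vec.dim ` f"

definition flags_of_type :: "nat set \<Rightarrow> ('a::field, 'n::finite) vec set set set" where
  "flags_of_type J = {f. flag f \<and> flag_type f = J}"

definition maximal_flag :: "('a::field, 'n::finite) vec set set \<Rightarrow> bool" where
  "maximal_flag M \<longleftrightarrow> flag M \<and> (\<forall>M'. flag M' \<and> M \<subseteq> M' \<longrightarrow> M' = M)"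

definition std_flag :: "('a::field, 'n::{finite,linorder}) vec set set" where
  "std_flag = {vec.span (std_basis ` {1..i}) | i. 1 \<le> i \<and> i < CARD('n)}"

definition GL :: "('a::field, 'n::finite) mat monoid" where
  "GL = \<lparr>carrier = {A. invertible A}, mult = (**), one = mat 1\<rparr>"

definition scalars :: "('a::field, 'n::finite) mat set" where
  "scalars = {mat c | c. c \<noteq> 0}"

definition PGL :: "('a::field, 'n::finite) mat set monoid" where
  "PGL = GL Mod scalars"

text \<open>
  An element of \<open>PGL\<close> is a set of matrices that differ by nonzero scalars, so all of them
  map a given subspace to the same image, which is therefore also the union of the images.
\<close>

definition act :: "('a::field, 'n::finite) mat set \<Rightarrow> ('a, 'n) vec set \<Rightarrow> ('a, 'n) vec set" where
  "act g U = (\<Union>A\<in>g. (\<lambda>v. A *v v) ` U)"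

definition act_flag :: "('a::field, 'n::finite) mat set \<Rightarrow> ('a, 'n) vec set set \<Rightarrow> ('a, 'n) vec set set" where
  "act_flag g f = act g ` f"

definition Borel :: "('a::field, 'n::{finite,linorder}) mat set set" where
  "Borel = stabilizer PGL act_flag std_flag"

text \<open>
  The element of \<open>PGL\<close> given by a permutation \<open>w\<close> of \<open>{1..n+1}\<close>: the class of the matrix
  whose linear map sends the \<open>i\<close>-th standard basis vector to the \<open>w i\<close>-th.
\<close>

definition perm_elt :: "(nat \<Rightarrow> nat) \<Rightarrow> ('a::field, 'n::{finite,linorder}) mat set" where
  "perm_elt w = scalars #>\<^bsub>GL\<^esub> (THE A. \<forall>i\<in>{1..CARD('n)}. A *v std_basis i = std_basis (w i))"

text \<open>\<open>w\<^sub>0 = (1, n+1)(2, n)\<dots>\<close>, with indices starting from 1\<close>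

definition longest_perm :: "nat \<Rightarrow> nat \<Rightarrow> nat" where
  "longest_perm n i = (if i \<in> {1..n+1} then n + 2 - i else i)"

definition double_coset :: "('a::field, 'n::{finite,linorder}) mat set \<Rightarrow> ('a, 'n) mat set set" where
  "double_coset x = Borel <#>\<^bsub>PGL\<^esub> {x} <#>\<^bsub>PGL\<^esub> Borel"

definition opposite_maximal ::
  "('a::field, 'n::{finite,linorder}) vec set set \<Rightarrow> ('a, 'n) vec set set \<Rightarrow> bool" where
  "opposite_maximal M M' \<longleftrightarrow>
     (\<exists>g\<in>carrier PGL. \<exists>h\<in>carrier PGL.
        M = act_flag g std_flag \<and> M' = act_flag h std_flag \<and>
        double_coset (inv\<^bsub>PGL\<^esub> h \<otimes>\<^bsub>PGL\<^esub> g) =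
        double_coset (perm_elt (longest_perm (CARD('n) - 1))))"

definition opposite_type :: "nat \<Rightarrow> nat set \<Rightarrow> nat set" where
  "opposite_type n J = (\<lambda>j. n + 1 - j) ` J"

definition opposite ::
  "('a::field, 'n::{finite,linorder}) vec set set \<Rightarrow> ('a, 'n) vec set set \<Rightarrow> bool" where
  "opposite f f' \<longleftrightarrow>
     flag f \<and> flag f' \<and>
     opposite_type (CARD('n) - 1) (flag_type f) = flag_type f' \<and>
     (\<exists>M M'. maximal_flag M \<and> maximal_flag M' \<and> f \<subseteq> M \<and> f' \<subseteq> M' \<and> opposite_maximal M M')"

definition EKR_set :: "nat set \<Rightarrow> ('a::field, 'n::{finite,linorder}) vec set set set \<Rightarrow> bool" where
  "EKR_set J S \<longleftrightarrow>
     opposite_type (CARD('n) - 1) J = J \<and> S \<subseteq> flags_of_type J \<and>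
     (\<forall>f\<in>S. \<forall>f'\<in>S. \<not> opposite f f')"

end

theory Submission
  imports Defs
begin

text \<open>
  Intersection property. If maximal flags \<open>M\<close> and \<open>M'\<close> are opposite, the equality of double cosets
  says that some \<open>A\<close> in the linear group satisfies \<open>M = A w\<^sub>0 F\<close> and \<open>M' = A F\<close> simultaneously
  (\<open>opposite_maximal_frame\<close>). In the frame given by the columns of \<open>A\<close>, the members of \<open>M'\<close> are
  spanned by initial segments and those of \<open>M\<close> by final segments, so members of complementary
  dimensions are complementary subspaces (\<open>opposite_members_complementary\<close>). For two flags in \<open>C\<close> the
  two members of dimension \<open>m\<close> either share a point or lie in a common hyperplane, which
  complementary subspaces of dimension \<open>m\<close> cannot do.

  Cardinality. The linear group preserves the set of flags of type \<open>J\<close> and is transitive on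
  nonzero vectors. So the number of flags whose \<open>m\<close>-dimensional member contains a nonzero
  vector \<open>x\<close> does not depend on \<open>x\<close>, and it equals \<open>|C|\<close> when \<open>x\<close> spans the fixed point. Since an
  \<open>m\<close>-dimensional subspace has \<open>q^m - 1\<close> nonzero vectors, counting incident pairs in two ways
  gives \<open>(q^(2m) - 1) |C| = (q^m - 1) v\<close>, that is \<open>(q^m + 1) |C| = v\<close>. For hyperplanes the same
  argument applies to nonzero coefficient vectors \<open>a\<close> of the equations \<open>a \<cdot> x = 0\<close>, because those vanishing on
  an \<open>m\<close>-dimensional subspace form, together with \<open>0\<close>, a space of order \<open>q^(2m - m)\<close>.
  Counting nonzero vectors instead of points and hyperplanes multiplies both counts by \<open>q - 1\<close>,
  and the action on vectors is the standard one.
\<close>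

section \<open>Invertible matrices acting on subspaces and flags\<close>

lemma invertible_matrix_inj: "inj ((*v) A)"
  if "invertible A" for A :: "('a::field, 'n::finite) mat"
  using that matrix_left_invertible_injective invertible_left_inverse by blast

lemma invertible_matrix_surj: "surj ((*v) A)"
  if "invertible A" for A :: "('a::field, 'n::finite) mat"
  using that matrix_right_invertible_surjective invertible_right_inverse by blast

lemma dim_image_invertible: "vec.dim ((*v) A ` U) = vec.dim U"
  if "invertible A" for A :: "('a::field, 'n::finite) mat"
  by (rule vec.dim_image_eq)
    (auto intro: inj_on_subset[OF invertible_matrix_inj[OF that]])

lemma subspace_image_matrix: "vec.subspace ((*v) A ` U)"
  if "vec.subspace U" for A :: "('a::field, 'n::finite) mat"
  using vec.subspace_image[OF that] .

lemma invertible_transpose: "invertible (transpose A)"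
  if "invertible A" for A :: "('a::field, 'n::finite) mat"
  using that by (meson invertible_def matrix_left_right_inverse right_invertible_transpose)

lemma ex_invertible_extending:
  fixes f :: "('a::field, 'n::finite) vec \<Rightarrow> ('a, 'n) vec"
  assumes "vec.independent B" "vec.independent (f ` B)" "inj_on f B"
  obtains A :: "('a, 'n) mat" where "invertible A" "\<forall>x\<in>B. A *v x = f x"
proof -
  obtain g where g: "Vector_Spaces.linear (*s) (*s) g" "inj g" "\<forall>x\<in>B. g x = f x"
    using vec.linear_independent_extend_inj[OF assms] by blast
  have mg: "(*v) (matrix g) = g"
    using matrix_works[OF g(1)] by auto
  have "invertible (matrix g)"
    using g(2) mg by (metis invertible_left_inverse matrix_left_invertible_injective)
  then show thesis using that g(3) mg by simp
qed

lemma ex_invertible_image_subspace: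
  fixes U W :: "('a::field, 'n::finite) vec set"
  assumes "vec.subspace U" "vec.subspace W" "vec.dim U = vec.dim W"
  obtains A :: "('a, 'n) mat" where "invertible A" "(*v) A ` U = W"
proof -
  obtain B where B: "B \<subseteq> U" "vec.independent B" "vec.span B = U" "card B = vec.dim U"
    using vec.basis_subspace_exists[OF assms(1)] by metis
  obtain B' where B': "B' \<subseteq> W" "vec.independent B'" "vec.span B' = W" "card B' = vec.dim W"
    using vec.basis_subspace_exists[OF assms(2)] by metis
  have "finite B" "finite B'"
    using B B' vec.finiteI_independent by auto
  then obtain f where f: "bij_betw f B B'"
    using B(4) B'(4) assms(3) by (metis finite_same_card_bij)
  then have fB: "f ` B = B'" "inj_on f B"
    by (auto simp: bij_betw_def)
  then obtain A :: "('a, 'n) mat" where A: "invertible A" "\<forall>x\<in>B. A *v x = f x"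
    using ex_invertible_extending[of B f] B(2) B'(2) by metis
  have "(*v) A ` vec.span B = vec.span ((*v) A ` B)"
    by (simp add: vec.span_image)
  also have "(*v) A ` B = B'"
    using A(2) fB(1) by auto
  finally have "(*v) A ` U = W" using B B' by simp
  with A(1) show thesis by (rule that)
qed

lemma ex_invertible_map_nonzero_vector:
  fixes x y :: "('a::field, 'n::finite) vec"
  assumes "x \<noteq> 0" "y \<noteq> 0"
  obtains A :: "('a, 'n) mat" where "invertible A" "A *v x = y"
  using ex_invertible_extending[of "{x}" "\<lambda>_. y"] assms by auto

lemma image_invertible_flags_of_type:
  fixes A :: "('a::field, 'n::finite) mat"
  assumes "invertible A" "f \<in> flags_of_type J"
  shows "(`) ((*v) A) ` f \<in> flags_of_type J"
proof -
  have inj: "inj ((*v) A)" and surj: "surj ((*v) A)"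
    using assms(1) invertible_matrix_inj invertible_matrix_surj by auto
  have f: "\<And>U. U \<in> f \<Longrightarrow> vec.subspace U \<and> U \<noteq> {0} \<and> U \<noteq> UNIV"
    "\<And>U W. U \<in> f \<Longrightarrow> W \<in> f \<Longrightarrow> U \<subseteq> W \<or> W \<subseteq> U" "vec.dim ` f = J"
    using assms(2) by (auto simp: flags_of_type_def flag_def flag_type_def)
  have "vec.subspace ((*v) A ` U) \<and> (*v) A ` U \<noteq> {0} \<and> (*v) A ` U \<noteq> UNIV" if "U \<in> f" for U
  proof -
    have "(*v) A ` U \<noteq> (*v) A ` {0}" "(*v) A ` U \<noteq> (*v) A ` UNIV"
      using f(1)[OF that] by (simp_all only: inj_image_eq_iff[OF inj] not_False_eq_True)
    then show ?thesis
      using f(1)[OF that] surj subspace_image_matrix by auto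
  qed
  moreover have "(*v) A ` U \<subseteq> (*v) A ` W \<or> (*v) A ` W \<subseteq> (*v) A ` U" if "U \<in> f" "W \<in> f" for U W
    using f(2)[OF that] by blast
  moreover have "vec.dim ` (`) ((*v) A) ` f = J"
    using f(3) by (simp add: image_image dim_image_invertible[OF assms(1)])
  ultimately show ?thesis
    unfolding flags_of_type_def flag_def flag_type_def by simp
qed

text \<open>
  By this uniqueness, the existential quantifier over members of dimension \<open>m\<close> in the description of
  \<open>C\<close> speaks of a single subspace, which makes the degrees in the double count computable.
\<close>

lemma flag_member_dim_unique:
  fixes f :: "('a::field, 'n::finite) vec set set"
  assumes "flag f" "U \<in> f" "W \<in> f" "vec.dim U = vec.dim W"
  shows "U = W"
proof -
  have sub: "vec.subspace U" "vec.subspace W" and "U \<subseteq> W \<or> W \<subseteq> U"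
    using assms(1-3) by (simp_all add: flag_def)
  then show ?thesis
    using vec.subspace_dim_equal[OF sub] vec.subspace_dim_equal[OF sub(2,1)] assms(4) by auto
qed

section \<open>Double counting of flags against points and hyperplanes\<close>

lemma card_coordinate_subspace:
  fixes I :: "'n::finite set"
  shows "card {x :: ('a::{field,finite}, 'n) vec. \<forall>i. i \<notin> I \<longrightarrow> x $ i = 0} = CARD('a) ^ card I"
proof -
  let ?S = "{x :: ('a, 'n) vec. \<forall>i. i \<notin> I \<longrightarrow> x $ i = 0}"
  have "bij_betw (\<lambda>x. restrict (($) x) I) ?S (I \<rightarrow>\<^sub>E UNIV)"
  proof (rule bij_betwI[where g = "\<lambda>h. \<chi> i. if i \<in> I then h i else 0"])
    show "(\<lambda>h. \<chi> i. if i \<in> I then h i else 0) \<in> (I \<rightarrow>\<^sub>E UNIV) \<rightarrow> ?S" by auto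
  next
    fix h :: "'n \<Rightarrow> 'a" assume "h \<in> I \<rightarrow>\<^sub>E UNIV"
    then show "restrict (($) (\<chi> i. if i \<in> I then h i else 0)) I = h"
      by (auto simp: restrict_def PiE_def extensional_def)
  qed (auto simp: vec_eq_iff)
  then have "card ?S = card (I \<rightarrow>\<^sub>E (UNIV :: 'a set))"
    by (rule bij_betw_same_card)
  then show ?thesis by (simp add: card_funcsetE)
qed

text \<open>
  Reduction to coordinates: since the linear group is transitive on subspaces of each dimension,
  cardinalities and annihilators need to be computed for coordinate subspaces only.
\<close>

lemma subspace_coordinate_image:
  fixes U :: "('a::field, 'n::finite) vec set"
  assumes "vec.subspace U"
  obtains A :: "('a, 'n) mat" and I where "invertible A" "card I = vec.dim U"
    "U = (*v) A ` {x. \<forall>i. i \<notin> I \<longrightarrow> x $ i = 0}"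
proof -
  have "vec.dim U \<le> CARD('n)"
    using vec.dim_subset_UNIV[of U] by (simp add: vec.dimension_def card_cart_basis)
  then obtain I :: "'n set" where I: "card I = vec.dim U"
    by (metis ex_card)
  have "vec.subspace {x :: ('a, 'n) vec. \<forall>i. i \<notin> I \<longrightarrow> x $ i = 0}"
    by (rule subspace_substandard_cart)
  then obtain A :: "('a, 'n) mat"
    where "invertible A" "(*v) A ` {x. \<forall>i. i \<notin> I \<longrightarrow> x $ i = 0} = U"
    using assms by (rule ex_invertible_image_subspace) (simp add: I dim_substandard_cart)
  with I show thesis using that by auto
qed

lemma card_subspace:
  fixes U :: "('a::{field,finite}, 'n::finite) vec set"
  assumes "vec.subspace U"
  shows "card U = CARD('a) ^ vec.dim U"
proof -
  obtain A :: "('a, 'n) mat" and I where A: "invertible A" "card I = vec.dim U"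
    "U = (*v) A ` {x. \<forall>i. i \<notin> I \<longrightarrow> x $ i = 0}"
    using subspace_coordinate_image[OF assms] .
  then have "card U = card {x :: ('a, 'n) vec. \<forall>i. i \<notin> I \<longrightarrow> x $ i = 0}"
    by (simp add: card_image inj_on_subset[OF invertible_matrix_inj])
  then show ?thesis using A by (simp add: card_coordinate_subspace)
qed

text \<open>
  For \<open>a = 0\<close> this is the whole space; for \<open>a \<noteq> 0\<close> it is a hyperplane, and every hyperplane
  arises from some nonzero \<open>a\<close>, unique up to a scalar.
\<close>

definition hyperplane_of :: "('a::field, 'n::finite) vec \<Rightarrow> ('a, 'n) vec set" where
  "hyperplane_of a = {x. scalar_product a x = 0}"

lemma scalar_product_matrix:
  "scalar_product a (A *v x) = scalar_product (transpose A *v a) x"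
  for A :: "('a::field, 'n::finite) mat"
  unfolding scalar_product_def matrix_vector_mult_def transpose_def
  by (simp add: sum_distrib_left sum_distrib_right mult_ac)
     (rule sum.swap)

text \<open>
  The dual action: moving subspaces by \<open>A\<close> moves equations by the inverse of the transpose of \<open>A\<close>.
\<close>

lemma image_subset_hyperplane_of:
  "(*v) A ` U \<subseteq> hyperplane_of a \<longleftrightarrow> U \<subseteq> hyperplane_of (transpose A *v a)"
  for A :: "('a::field, 'n::finite) mat"
  by (auto simp: hyperplane_of_def scalar_product_matrix)

lemma coordinate_subset_hyperplane_of:
  "{x. \<forall>i. i \<notin> I \<longrightarrow> x $ i = 0} \<subseteq> hyperplane_of a \<longleftrightarrow> (\<forall>i\<in>I. a $ i = 0)"
  for a :: "('a::field, 'n::finite) vec"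
proof
  assume *: "{x. \<forall>i. i \<notin> I \<longrightarrow> x $ i = 0} \<subseteq> hyperplane_of a"
  show "\<forall>i\<in>I. a $ i = 0"
  proof
    fix i assume "i \<in> I"
    then have "axis i 1 \<in> hyperplane_of a"
      using * by (auto simp: axis_def)
    then show "a $ i = 0"
      by (simp add: hyperplane_of_def scalar_product_def axis_def if_distrib cong: if_cong)
  qed
next
  assume "\<forall>i\<in>I. a $ i = 0"
  then show "{x. \<forall>i. i \<notin> I \<longrightarrow> x $ i = 0} \<subseteq> hyperplane_of a"
    by (auto simp: hyperplane_of_def scalar_product_def intro!: sum.neutral)
qed

text \<open>
  After a change of coordinates the equations vanishing on \<open>U\<close> are those whose coefficients on \<open>I\<close>
  are zero, so they form a coordinate subspace of the complementary dimension.
\<close>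

lemma card_hyperplanes_containing:
  fixes U :: "('a::{field,finite}, 'n::finite) vec set"
  assumes "vec.subspace U"
  shows "card {a. U \<subseteq> hyperplane_of a} = CARD('a) ^ (CARD('n) - vec.dim U)"
proof -
  obtain A :: "('a, 'n) mat" and I where A: "invertible A" "card I = vec.dim U"
    "U = (*v) A ` {x. \<forall>i. i \<notin> I \<longrightarrow> x $ i = 0}"
    using subspace_coordinate_image[OF assms] .
  have "{a. U \<subseteq> hyperplane_of a} = (*v) (transpose A) -` {a. \<forall>i. i \<notin> - I \<longrightarrow> a $ i = 0}"
    unfolding A(3) image_subset_hyperplane_of coordinate_subset_hyperplane_of by auto
  moreover have "card ((*v) (transpose A) -` {a. \<forall>i. i \<notin> - I \<longrightarrow> a $ i = 0}) =
      card {a :: ('a, 'n) vec. \<forall>i. i \<notin> - I \<longrightarrow> a $ i = 0}"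
    using invertible_matrix_surj[OF invertible_transpose[OF A(1)]]
    by (intro card_vimage_inj invertible_matrix_inj invertible_transpose A(1)) simp
  ultimately have "card {a. U \<subseteq> hyperplane_of a} =
      card {a :: ('a, 'n) vec. \<forall>i. i \<notin> - I \<longrightarrow> a $ i = 0}"
    by (simp only:)
  also have "\<dots> = CARD('a) ^ (CARD('n) - vec.dim U)"
    using card_coordinate_subspace[of "- I", where 'a = 'a] A(2) by (simp add: Compl_eq_Diff_UNIV card_Diff_subset)
  finally show ?thesis .
qed

lemma hyperplane_eq_hyperplane_of:
  fixes H :: "('a::field, 'n::finite) vec set"
  assumes "vec.subspace H" "vec.dim H + 1 = CARD('n)"
  obtains a where "a \<noteq> 0" "H = hyperplane_of a"
proof -
  obtain A :: "('a, 'n) mat" and I where A: "invertible A" "card I = vec.dim H"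
    "H = (*v) A ` {x. \<forall>i. i \<notin> I \<longrightarrow> x $ i = 0}"
    using subspace_coordinate_image[OF assms(1)] .
  have "card (- I) = 1" using A(2) assms(2) by (simp add: Compl_eq_Diff_UNIV card_Diff_subset)
  then obtain k where k: "- I = {k}" by (auto simp: card_1_singleton_iff)
  obtain a where a: "transpose A *v a = axis k 1"
    using invertible_matrix_surj[OF invertible_transpose[OF A(1)]] by (metis surjD)
  have a0: "a \<noteq> 0" using a by (auto simp: axis_eq_0_iff)
  have "A *v x \<in> hyperplane_of a \<longleftrightarrow> x $ k = 0" for x
    by (simp add: hyperplane_of_def scalar_product_matrix a del: transpose_matrix_vector)
       (simp add: scalar_product_def axis_def if_distrib if_distribR cong: if_cong)
  moreover have "x \<in> {x :: ('a, 'n) vec. \<forall>i. i \<notin> I \<longrightarrow> x $ i = 0} \<longleftrightarrow> x $ k = 0" for x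
    using k by auto
  ultimately have "H = hyperplane_of a"
    unfolding A(3) using invertible_matrix_surj[OF A(1)] by (auto simp: image_iff) (metis surjD)
  with a0 show thesis by (rule that)
qed

text \<open>
  The double count behind both cases. Assumption \<open>trans\<close> transports incidences with \<open>y\<close> to
  incidences with \<open>z\<close> along an invertible matrix, which permutes the flags of type \<open>J\<close>; used in both
  directions it shows that all elements of \<open>X\<close> are incident with equally many flags. Assumption \<open>deg\<close>
  gives the degree on the side of the flags.
\<close>

lemma card_flags_incident:
  fixes X :: "'b set" and R :: "'b \<Rightarrow> ('a::{field,finite}, 'n::finite) vec set \<Rightarrow> bool"
  assumes fin: "finite X" and x: "x \<in> X" and m: "m \<in> J"
    and trans: "\<And>y z. y \<in> X \<Longrightarrow> z \<in> X \<Longrightarrow>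
      \<exists>A :: ('a, 'n) mat. invertible A \<and> (\<forall>U. R y U \<longrightarrow> R z ((*v) A ` U))"
    and deg: "\<And>U. vec.subspace U \<Longrightarrow> vec.dim U = m \<Longrightarrow> card {y\<in>X. R y U} = d"
  shows "card X * card {f\<in>flags_of_type J. \<exists>U\<in>f. vec.dim U = m \<and> R x U} =
    d * card (flags_of_type J :: ('a, 'n) vec set set set)"
proof -
  let ?E = "\<lambda>y f. \<exists>U\<in>f. vec.dim U = m \<and> R y U"
  let ?F = "\<lambda>y. {f\<in>flags_of_type J. ?E y f}"
  have le: "card (?F y) \<le> card (?F z)" if yz: "y \<in> X" "z \<in> X" for y z
  proof -
    obtain A :: "('a, 'n) mat" where A: "invertible A" "\<And>U. R y U \<Longrightarrow> R z ((*v) A ` U)"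
      using trans[OF yz] by blast
    have "inj ((`) ((*v) A))"
      using inj_image_eq_iff[OF invertible_matrix_inj[OF A(1)]] by (simp add: inj_def)
    then have "inj ((`) ((`) ((*v) A)))"
      by (simp add: inj_image_eq_iff inj_def[of "(`) ((`) ((*v) A))"])
    then have "inj_on ((`) ((`) ((*v) A))) (?F y)" by (rule inj_on_subset) simp
    moreover have "(`) ((`) ((*v) A)) ` ?F y \<subseteq> ?F z"
    proof clarify
      fix f U assume f: "f \<in> flags_of_type J" "U \<in> f" "R y U" "m = vec.dim U"
      have "?E z ((`) ((*v) A) ` f)" if "m = vec.dim U"
        using f A(2)[of U] that by (auto simp: dim_image_invertible[OF A(1)])
      then show "(`) ((*v) A) ` f \<in> flags_of_type J \<and>
          (\<exists>W\<in>(`) ((*v) A) ` f. vec.dim W = vec.dim U \<and> R z W)"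
        using image_invertible_flags_of_type[OF A(1) f(1)] f(4) by auto
    qed
    ultimately show ?thesis by (rule card_inj_on_le) simp
  qed
  have "card {y\<in>X. ?E y f} = d" if f: "f \<in> flags_of_type J" for f
  proof -
    obtain U where U: "U \<in> f" "vec.dim U = m"
      using f m by (auto simp: flags_of_type_def flag_type_def)
    have fl: "flag f" using f by (simp add: flags_of_type_def)
    have "?E y f \<longleftrightarrow> R y U" for y
      using U flag_member_dim_unique[OF fl] by metis
    then show ?thesis using deg U fl by (simp add: flag_def)
  qed
  then have "(\<Sum>y\<in>X. card (?F y)) = d * card (flags_of_type J :: ('a, 'n) vec set set set)"
    using fin by (intro sum_multicount) auto
  moreover have "(\<Sum>y\<in>X. card (?F y)) = (\<Sum>y\<in>X. card (?F x))"
    using le x by (intro sum.cong) (auto intro: antisym)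
  ultimately show ?thesis by simp
qed

lemma card_flags_through_point:
  fixes P :: "('a::{field,finite}, 'n::finite) vec set"
  assumes "P \<in> subspaces_of_dim 1" "m \<in> J"
  shows "(CARD('a) ^ CARD('n) - 1) *
      card {f\<in>flags_of_type J. \<exists>U\<in>f. vec.dim U = m \<and> P \<subseteq> U} =
    (CARD('a) ^ m - 1) * card (flags_of_type J :: ('a, 'n) vec set set set)"
proof -
  have P: "vec.subspace P" "vec.dim P = 1"
    using assms by (auto simp: subspaces_of_dim_def)
  obtain B where B: "B \<subseteq> P" "vec.independent B" "vec.span B = P" "card B = 1"
    using vec.basis_subspace_exists[OF P(1)] P(2) by metis
  then obtain x where x: "B = {x}" by (auto simp: card_1_singleton_iff)
  have "x \<noteq> 0" using B(2) x by auto
  let ?X = "UNIV - {0 :: ('a, 'n) vec}"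
  have deg: "card {y\<in>?X. y \<in> U} = CARD('a) ^ m - 1"
    if "vec.subspace U" "vec.dim U = m" for U :: "('a, 'n) vec set"
  proof -
    have "{y\<in>?X. y \<in> U} = U - {0}" by auto
    then show ?thesis
      using that vec.subspace_0[OF that(1)] by (simp add: card_subspace)
  qed
  have trans: "\<exists>A :: ('a, 'n) mat. invertible A \<and> (\<forall>U. y \<in> U \<longrightarrow> z \<in> (*v) A ` U)"
    if "y \<in> ?X" "z \<in> ?X" for y z
    using ex_invertible_map_nonzero_vector[of y z] that by (metis Diff_iff image_eqI insertCI)
  have "card ?X * card {f\<in>flags_of_type J. \<exists>U\<in>f. vec.dim U = m \<and> x \<in> U} =
      (CARD('a) ^ m - 1) * card (flags_of_type J :: ('a, 'n) vec set set set)"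
    by (rule card_flags_incident[where R = "(\<in>)" and X = ?X, OF _ _ assms(2) trans deg])
      (use \<open>x \<noteq> 0\<close> in simp_all)
  moreover have "x \<in> U \<longleftrightarrow> P \<subseteq> U" if "vec.subspace U" for U
    using B x that by (metis insert_subset vec.span_minimal singletonD subset_iff)
  then have "{f\<in>flags_of_type J. \<exists>U\<in>f. vec.dim U = m \<and> x \<in> U} =
      {f\<in>flags_of_type J. \<exists>U\<in>f. vec.dim U = m \<and> P \<subseteq> U}"
    by (auto simp: flags_of_type_def flag_def)
  moreover have "card ?X = CARD('a) ^ CARD('n) - 1"
    by (simp add: card_Diff_singleton CARD_vec)
  ultimately show ?thesis by simp
qed

lemma card_flags_in_hyperplane:
  fixes H :: "('a::{field,finite}, 'n::finite) vec set"
  assumes "H \<in> subspaces_of_dim (CARD('n) - 1)" "m \<in> J"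
  shows "(CARD('a) ^ CARD('n) - 1) *
      card {f\<in>flags_of_type J. \<exists>U\<in>f. vec.dim U = m \<and> U \<subseteq> H} =
    (CARD('a) ^ (CARD('n) - m) - 1) * card (flags_of_type J :: ('a, 'n) vec set set set)"
proof -
  have "vec.subspace H" "vec.dim H + 1 = CARD('n)"
    using assms by (auto simp: subspaces_of_dim_def)
  then obtain a where a: "a \<noteq> 0" "H = hyperplane_of a"
    by (rule hyperplane_eq_hyperplane_of)
  let ?X = "UNIV - {0 :: ('a, 'n) vec}"
  have deg: "card {b\<in>?X. U \<subseteq> hyperplane_of b} = CARD('a) ^ (CARD('n) - m) - 1"
    if "vec.subspace U" "vec.dim U = m" for U :: "('a, 'n) vec set"
  proof -
    have "{b\<in>?X. U \<subseteq> hyperplane_of b} = {b. U \<subseteq> hyperplane_of b} - {0}" by auto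
    moreover have "0 \<in> {b. U \<subseteq> hyperplane_of b}"
      by (auto simp: hyperplane_of_def scalar_product_def)
    ultimately show ?thesis
      using that by (simp add: card_hyperplanes_containing)
  qed
  \<comment> \<open>The transpose of a matrix that maps \<open>c\<close> to \<open>b\<close> moves the equation \<open>b\<close> to the equation \<open>c\<close>.\<close>
  have trans: "\<exists>A :: ('a, 'n) mat. invertible A \<and>
      (\<forall>U. U \<subseteq> hyperplane_of b \<longrightarrow> (*v) A ` U \<subseteq> hyperplane_of c)"
    if "b \<in> ?X" "c \<in> ?X" for b c
  proof -
    have "c \<noteq> 0" "b \<noteq> 0" using that by auto
    then obtain A :: "('a, 'n) mat" where A: "invertible A" "A *v c = b"
      by (rule ex_invertible_map_nonzero_vector)
    then show ?thesis
      using invertible_transpose[OF A(1)]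
      by (intro exI[of _ "transpose A"])
        (simp add: image_subset_hyperplane_of del: transpose_matrix_vector)
  qed
  have "card ?X * card {f\<in>flags_of_type J. \<exists>U\<in>f. vec.dim U = m \<and> U \<subseteq> hyperplane_of a} =
      (CARD('a) ^ (CARD('n) - m) - 1) * card (flags_of_type J :: ('a, 'n) vec set set set)"
    by (rule card_flags_incident[where R = "\<lambda>b U. U \<subseteq> hyperplane_of b" and X = ?X,
          OF _ _ assms(2) trans deg])
      (use a in simp_all)
  moreover have "card ?X = CARD('a) ^ CARD('n) - 1"
    by (simp add: card_Diff_singleton CARD_vec)
  ultimately show ?thesis using a by simp
qed

section \<open>Opposite maximal flags\<close>

lemma scalar_matrix_vector: "mat c *v x = c *s x"
  for x :: "('a::field, 'n::finite) vec"
  by (simp add: vec_eq_iff matrix_vector_mult_def mat_def if_distrib if_distribR cong: if_cong)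

lemma scalar_mat_mult: "mat c ** mat d = (mat (c * d) :: ('a::field, 'n::finite) mat)"
  by (simp add: matrix_eq scalar_matrix_vector flip: matrix_vector_mul_assoc)

lemma scalar_mat_commute: "mat c ** A = A ** mat c"
  for A :: "('a::field, 'n::finite) mat"
  by (simp add: matrix_eq scalar_matrix_vector vec.scale flip: matrix_vector_mul_assoc)

lemma invertible_scalar_mat: "c \<noteq> 0 \<Longrightarrow> invertible (mat c :: ('a::field, 'n::finite) mat)"
  unfolding invertible_def
  by (rule exI[of _ "mat (inverse c)"]) (simp add: scalar_mat_mult)

lemma group_GL: "group (GL :: ('a::field, 'n::finite) mat monoid)"
proof (rule groupI)
  fix A :: "('a, 'n) mat" assume "A \<in> carrier GL"
  then show "\<exists>B\<in>carrier GL. B \<otimes>\<^bsub>GL\<^esub> A = \<one>\<^bsub>GL\<^esub>"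
    by (auto simp: GL_def invertible_def)
qed (auto simp: GL_def invertible_mult matrix_mul_assoc intro: invertible_scalar_mat[of 1])

lemma normal_scalars: "scalars \<lhd> (GL :: ('a::field, 'n::finite) mat monoid)"
proof -
  interpret group "GL :: ('a, 'n) mat monoid" by (rule group_GL)
  have inv: "inv\<^bsub>GL\<^esub> (mat c) = (mat (inverse c) :: ('a, 'n) mat)" if "c \<noteq> 0" for c
    using that by (intro inv_equality) (auto simp: GL_def scalar_mat_mult invertible_scalar_mat)
  have sub: "subgroup scalars (GL :: ('a, 'n) mat monoid)"
  proof (rule subgroupI)
    show "scalars \<noteq> ({} :: ('a, 'n) mat set)"
      by (auto simp: scalars_def intro: exI[of _ 1])
    fix a :: "('a, 'n) mat" assume "a \<in> scalars"
    then obtain c where "a = mat c" "c \<noteq> 0" by (auto simp: scalars_def)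
    then show "inv\<^bsub>GL\<^esub> a \<in> scalars" using inv[of c]
      by (auto simp: scalars_def intro!: exI[of _ "inverse c"])
  next
    fix a b :: "('a, 'n) mat" assume "a \<in> scalars" "b \<in> scalars"
    then show "a \<otimes>\<^bsub>GL\<^esub> b \<in> scalars"
      by (auto simp: scalars_def GL_def scalar_mat_mult)
  qed (auto simp: scalars_def GL_def invertible_scalar_mat)
  show ?thesis
    unfolding normal_inv_iff
  proof (intro conjI ballI sub)
    fix x h :: "('a, 'n) mat" assume x: "x \<in> carrier GL" and h: "h \<in> scalars"
    have hc: "h \<in> carrier GL" using h subgroup.subset[OF sub] by auto
    have "x \<otimes>\<^bsub>GL\<^esub> h = h \<otimes>\<^bsub>GL\<^esub> x"
      using h by (auto simp: GL_def scalars_def scalar_mat_commute)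
    then have "x \<otimes>\<^bsub>GL\<^esub> h \<otimes>\<^bsub>GL\<^esub> inv\<^bsub>GL\<^esub> x = h"
      using x hc by (simp add: m_assoc)
    then show "x \<otimes>\<^bsub>GL\<^esub> h \<otimes>\<^bsub>GL\<^esub> inv\<^bsub>GL\<^esub> x \<in> scalars" using h by simp
  qed
qed

lemma group_PGL: "group (PGL :: ('a::field, 'n::finite) mat set monoid)"
  unfolding PGL_def by (rule normal.factorgroup_is_group[OF normal_scalars])

text \<open>
  The product in the quotient group is the elementwise product of sets of matrices, and the action
  takes the union over all of them. So this law holds for arbitrary sets of matrices, and
  representatives need not be chosen.
\<close>

lemma act_mult: "act (g \<otimes>\<^bsub>PGL\<^esub> h) U = act g (act h U)"
  for g h :: "('a::field, 'n::finite) mat set"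
  by (simp add: PGL_def FactGroup_def act_def set_mult_def GL_def image_UN image_image
      matrix_vector_mul_assoc) blast

lemma act_flag_mult: "act_flag (g \<otimes>\<^bsub>PGL\<^esub> h) f = act_flag g (act_flag h f)"
  for g h :: "('a::field, 'n::finite) mat set"
  by (simp add: act_flag_def act_mult image_image)

lemma image_scalar_subspace:
  fixes U :: "('a::field, 'n::finite) vec set"
  assumes "vec.subspace U" "c \<noteq> 0"
  shows "(*v) (mat c) ` U = U"
proof
  show "(*v) (mat c) ` U \<subseteq> U"
    using assms by (auto simp: scalar_matrix_vector vec.subspace_scale)
  show "U \<subseteq> (*v) (mat c) ` U"
  proof
    fix x assume "x \<in> U"
    then have "inverse c *s x \<in> U" "x = mat c *v (inverse c *s x)"
      using assms by (auto simp: scalar_matrix_vector vec.subspace_scale)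
    then show "x \<in> (*v) (mat c) ` U" by blast
  qed
qed

lemma act_scalars:
  fixes A :: "('a::field, 'n::finite) mat"
  assumes "vec.subspace U"
  shows "act (scalars #>\<^bsub>GL\<^esub> A) U = (*v) A ` U"
proof -
  have "act (scalars #>\<^bsub>GL\<^esub> A) U = (\<Union>c\<in>-{0}. (*v) (mat c) ` (*v) A ` U)"
    by (auto simp: act_def r_coset_def GL_def scalars_def image_image simp flip: matrix_vector_mul_assoc)
  also have "\<dots> = (\<Union>c\<in>-{0::'a}. (*v) A ` U)"
    using image_scalar_subspace[OF subspace_image_matrix[OF assms]] by (intro SUP_cong) auto
  also have "\<dots> = (*v) A ` U"
  proof -
    have "(1::'a) \<in> -{0}" by simp
    then show ?thesis by blast
  qed
  finally show ?thesis .
qed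

lemma PGL_carrierE:
  fixes g :: "('a::field, 'n::finite) mat set"
  assumes "g \<in> carrier PGL"
  obtains A where "invertible A" "g = scalars #>\<^bsub>GL\<^esub> A"
  using assms by (auto simp: PGL_def FactGroup_def RCOSETS_def GL_def)

lemma PGL_carrierI:
  fixes A :: "('a::field, 'n::finite) mat"
  assumes "invertible A" shows "scalars #>\<^bsub>GL\<^esub> A \<in> carrier PGL"
  using assms by (auto simp: PGL_def FactGroup_def RCOSETS_def GL_def)

lemma act_flag_one:
  fixes f :: "('a::field, 'n::finite) vec set set"
  assumes "\<And>U. U \<in> f \<Longrightarrow> vec.subspace U"
  shows "act_flag \<one>\<^bsub>PGL\<^esub> f = f"
proof -
  have "act \<one>\<^bsub>PGL\<^esub> U = U" if "vec.subspace U" for U :: "('a, 'n) vec set"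
  proof -
    have "\<one>\<^bsub>PGL\<^esub> = scalars #>\<^bsub>GL\<^esub> (mat 1 :: ('a, 'n) mat)"
      by (simp add: PGL_def FactGroup_def r_coset_def GL_def)
    then show ?thesis using act_scalars[OF that] by simp
  qed
  then show ?thesis using assms by (simp add: act_flag_def)
qed

definition std_index :: "nat \<Rightarrow> 'n::{finite,linorder}" where
  "std_index i = sorted_list_of_set (UNIV :: 'n set) ! (i - 1)"

lemma std_basis_axis: "std_basis i = axis (std_index i) 1"
  by (simp add: std_basis_def std_index_def)

lemma bij_betw_std_index:
  "bij_betw (std_index :: nat \<Rightarrow> 'n) {1..CARD('n)} (UNIV :: 'n::{finite,linorder} set)"
proof -
  let ?l = "sorted_list_of_set (UNIV :: 'n set)"
  have "bij_betw ((!) ?l) {..<CARD('n)} UNIV"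
    using bij_betw_nth[of ?l "{..<length ?l}" UNIV] by simp
  moreover have "bij_betw (\<lambda>i. i - 1) {1..CARD('n)} {..<CARD('n)}"
    by (rule bij_betwI[where g = Suc]) auto
  ultimately have "bij_betw ((!) ?l \<circ> (\<lambda>i. i - 1)) {1..CARD('n)} UNIV"
    by (rule bij_betw_trans[rotated])
  then show ?thesis by (simp add: std_index_def comp_def cong: bij_betw_cong)
qed

lemma inj_on_std_index: "inj_on (std_index :: nat \<Rightarrow> 'n::{finite,linorder}) {1..CARD('n)}"
  using bij_betw_std_index by (rule bij_betw_imp_inj_on)

lemma inj_on_std_basis:
  "inj_on (std_basis :: nat \<Rightarrow> ('a::field, 'n::{finite,linorder}) vec) {1..CARD('n)}"
  using inj_on_std_index by (auto simp: inj_on_def std_basis_axis axis_eq_axis)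

lemma std_basis_cart_basis:
  "std_basis ` {1..CARD('n)} = (cart_basis :: ('a::field, 'n::{finite,linorder}) vec set)"
proof -
  have "std_basis ` {1..CARD('n)} =
      (\<lambda>k. axis k 1 :: ('a, 'n) vec) ` std_index ` {1..CARD('n)}"
    by (simp add: image_image std_basis_axis)
  also have "\<dots> = cart_basis"
    using bij_betw_std_index[where 'n = 'n] by (auto simp: bij_betw_def cart_basis_def)
  finally show ?thesis .
qed

lemma independent_std_basis:
  assumes "I \<subseteq> {1..CARD('n)}"
  shows "vec.independent (std_basis ` I :: ('a::field, 'n::{finite,linorder}) vec set)"
    and "card (std_basis ` I :: ('a, 'n) vec set) = card I"
proof -
  have "std_basis ` I \<subseteq> (cart_basis :: ('a, 'n) vec set)"
    unfolding std_basis_cart_basis[symmetric] using assms by (rule image_mono)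
  then show "vec.independent (std_basis ` I :: ('a, 'n) vec set)"
    by (rule vec.independent_mono[OF independent_cart_basis])
  show "card (std_basis ` I :: ('a, 'n) vec set) = card I"
    by (rule card_image[OF inj_on_subset[OF inj_on_std_basis assms]])
qed

lemma dim_span_std_basis:
  assumes "I \<subseteq> {1..CARD('n)}"
  shows "vec.dim (vec.span (std_basis ` I) :: ('a::field, 'n::{finite,linorder}) vec set) = card I"
  using independent_std_basis[OF assms, where 'a = 'a]
  by (simp add: vec.dim_eq_card_independent)

abbreviation std_subspace :: "nat \<Rightarrow> ('a::field, 'n::{finite,linorder}) vec set" where
  "std_subspace i \<equiv> vec.span (std_basis ` {1..i})"

lemma std_flag_altdef:
  "std_flag = (std_subspace ` {1..<CARD('n)} :: ('a::field, 'n::{finite,linorder}) vec set set)"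
  by (auto simp: std_flag_def)

text \<open>
  The definite description in the definition of \<open>perm_elt\<close> denotes a matrix because reversing the
  standard basis extends to exactly one linear map.
\<close>

lemma perm_elt_longest:
  obtains W :: "('a::field, 'n::{finite,linorder}) mat" where
    "invertible W"
    "\<forall>i\<in>{1..CARD('n)}. W *v std_basis i = std_basis (CARD('n) + 1 - i)"
    "perm_elt (longest_perm (CARD('n) - 1)) = scalars #>\<^bsub>GL\<^esub> W"
proof -
  let ?E = "std_basis :: nat \<Rightarrow> ('a, 'n) vec" and ?N = "CARD('n)"
  let ?w = "longest_perm (?N - 1)"
  have w: "?w i = ?N + 1 - i" if "i \<in> {1..?N}" for i
    using that by (auto simp: longest_perm_def)
  have inv: "inv_into {1..?N} ?E (?E i) = i" if "i \<in> {1..?N}" for i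
    using inj_on_std_basis that by (rule inv_into_f_f)
  define f where "f = (\<lambda>x. ?E (?w (inv_into {1..?N} ?E x)))"
  have f: "f (?E i) = ?E (?N + 1 - i)" if "i \<in> {1..?N}" for i
    unfolding f_def inv[OF that] w[OF that] ..
  have "f ` ?E ` {1..?N} \<subseteq> ?E ` {1..?N}"
  proof clarify
    fix i assume i: "i \<in> {1..?N}"
    then have "?N + 1 - i \<in> {1..?N}" by auto
    then show "f (?E i) \<in> ?E ` {1..?N}" unfolding f[OF i] by (rule imageI)
  qed
  then have "vec.independent (f ` ?E ` {1..?N})"
    unfolding std_basis_cart_basis by (rule vec.independent_mono[OF independent_cart_basis])
  moreover have "inj_on f (?E ` {1..?N})"
  proof (rule inj_onI)
    fix x y assume "x \<in> ?E ` {1..?N}" "y \<in> ?E ` {1..?N}" and eq: "f x = f y"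
    then obtain i j where ij: "i \<in> {1..?N}" "j \<in> {1..?N}" "x = ?E i" "y = ?E j" by blast
    have "?E (?N + 1 - i) = ?E (?N + 1 - j)" using eq ij f by metis
    then have "?N + 1 - i = ?N + 1 - j"
      by (rule inj_onD[OF inj_on_std_basis]) (use ij in auto)
    then have "i = j" using ij by auto
    then show "x = y" using ij by simp
  qed
  ultimately obtain W :: "('a, 'n) mat"
    where inv_W: "invertible W" and "\<forall>x\<in>?E ` {1..?N}. W *v x = f x"
    using ex_invertible_extending[of "?E ` {1..?N}" f] independent_cart_basis
    unfolding std_basis_cart_basis by blast
  then have W: "W *v ?E i = ?E (?N + 1 - i)" if "i \<in> {1..?N}" for i
    using that by (simp add: f)
  have "(THE A. \<forall>i\<in>{1..?N}. A *v ?E i = ?E (?w i)) = W"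
  proof (rule the_equality)
    fix A assume A: "\<forall>i\<in>{1..?N}. A *v ?E i = ?E (?w i)"
    have "A *v x = W *v x" for x
    proof (rule vec.linear_eq_on[where f = "(*v) A" and g = "(*v) W" and B = "?E ` {1..?N}"])
      show "x \<in> vec.span (?E ` {1..?N})" unfolding std_basis_cart_basis by simp
      show "A *v b = W *v b" if "b \<in> ?E ` {1..?N}" for b
        using that A W by (auto simp: w simp del: One_nat_def)
    qed simp_all
    then show "A = W" by (simp add: matrix_eq)
  qed (simp add: W w del: One_nat_def)
  then show thesis
    using that[OF inv_W] W by (simp add: perm_elt_def del: One_nat_def)
qed

text \<open>
  Write \<open>M = gF\<close> and \<open>M' = hF\<close>. As \<open>h\<^sup>-\<^sup>1 g\<close> lies in its own double coset, it equals \<open>b w\<^sub>0 c\<close> with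
  \<open>b\<close> and \<open>c\<close> fixing \<open>F\<close>. Hence \<open>M = h b w\<^sub>0 F\<close> and \<open>M' = h b F\<close>, and \<open>A\<close> is any matrix
  representing \<open>h b\<close>.
\<close>

lemma opposite_maximal_frame:
  fixes M M' :: "('a::field, 'n::{finite,linorder}) vec set set"
  assumes "opposite_maximal M M'"
  obtains A W :: "('a, 'n) mat" where "invertible A"
    "\<forall>i\<in>{1..CARD('n)}. W *v std_basis i = std_basis (CARD('n) + 1 - i)"
    "M = (\<lambda>i. (*v) A ` (*v) W ` std_subspace i) ` {1..<CARD('n)}"
    "M' = (\<lambda>i. (*v) A ` std_subspace i) ` {1..<CARD('n)}"
proof -
  interpret PGL: group "PGL :: ('a, 'n) mat set monoid" by (rule group_PGL)
  let ?F = "std_flag :: ('a, 'n) vec set set"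
  obtain g h where g: "g \<in> carrier PGL" and h: "h \<in> carrier PGL"
    and M: "M = act_flag g ?F" and M': "M' = act_flag h ?F"
    and dc: "double_coset (inv\<^bsub>PGL\<^esub> h \<otimes>\<^bsub>PGL\<^esub> g) =
      double_coset (perm_elt (longest_perm (CARD('n) - 1)))"
    using assms unfolding opposite_maximal_def by blast
  obtain W :: "('a, 'n) mat" where W: "invertible W"
    "\<forall>i\<in>{1..CARD('n)}. W *v std_basis i = std_basis (CARD('n) + 1 - i)"
    "perm_elt (longest_perm (CARD('n) - 1)) = scalars #>\<^bsub>GL\<^esub> W"
    by (rule perm_elt_longest[where 'a = 'a and 'n = 'n])
  define w where "w = scalars #>\<^bsub>GL\<^esub> W"
  have w: "w \<in> carrier PGL" unfolding w_def using W(1) by (rule PGL_carrierI)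
  define x where "x = inv\<^bsub>PGL\<^esub> h \<otimes>\<^bsub>PGL\<^esub> g"
  have x: "x \<in> carrier PGL" unfolding x_def using g h by simp
  have "act_flag \<one>\<^bsub>PGL\<^esub> ?F = ?F"
    by (rule act_flag_one) (auto simp: std_flag_altdef)
  then have one: "\<one>\<^bsub>PGL\<^esub> \<in> (Borel :: ('a, 'n) mat set set)"
    by (simp add: Borel_def stabilizer_def)
  have "\<one>\<^bsub>PGL\<^esub> \<otimes>\<^bsub>PGL\<^esub> x \<otimes>\<^bsub>PGL\<^esub> \<one>\<^bsub>PGL\<^esub> \<in> double_coset x"
    unfolding double_coset_def set_mult_def using one by blast
  then have "x \<in> double_coset w" using x dc W(3) by (simp add: w_def x_def)
  then obtain b c where b: "b \<in> Borel" and c: "c \<in> Borel"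
    and xbc: "x = b \<otimes>\<^bsub>PGL\<^esub> w \<otimes>\<^bsub>PGL\<^esub> c"
    unfolding double_coset_def set_mult_def by blast
  have bc: "b \<in> carrier PGL" "act_flag b ?F = ?F" "act_flag c ?F = ?F"
    using b c by (auto simp: Borel_def stabilizer_def)
  have gx: "g = h \<otimes>\<^bsub>PGL\<^esub> x"
    using g h by (simp add: x_def PGL.m_assoc[symmetric])
  have M: "M = act_flag (h \<otimes>\<^bsub>PGL\<^esub> b) (act_flag w ?F)"
    unfolding M gx xbc by (simp add: act_flag_mult bc)
  have M': "M' = act_flag (h \<otimes>\<^bsub>PGL\<^esub> b) ?F"
    unfolding M' by (simp add: act_flag_mult bc)
  have "h \<otimes>\<^bsub>PGL\<^esub> b \<in> carrier PGL" using h bc by simp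
  then obtain A where A: "invertible A" "h \<otimes>\<^bsub>PGL\<^esub> b = scalars #>\<^bsub>GL\<^esub> A"
    by (rule PGL_carrierE)
  show thesis
  proof
    show "M = (\<lambda>i. (*v) A ` (*v) W ` std_subspace i) ` {1..<CARD('n)}"
      unfolding M A(2) w_def act_flag_def std_flag_altdef image_image[symmetric]
      by (simp add: image_image act_scalars subspace_image_matrix)
    show "M' = (\<lambda>i. (*v) A ` std_subspace i) ` {1..<CARD('n)}"
      unfolding M' A(2) act_flag_def std_flag_altdef
      by (simp add: image_image act_scalars)
  qed (use A W in auto)
qed

text \<open>The two spans consist of vectors supported on disjoint sets of coordinates.\<close>

lemma span_std_basis_disjoint:
  fixes I K :: "nat set"
  assumes "I \<subseteq> {1..CARD('n)}" "K \<subseteq> {1..CARD('n)}" "I \<inter> K = {}"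
  shows "vec.span (std_basis ` I) \<inter> vec.span (std_basis ` K) =
    ({0} :: ('a::field, 'n::{finite,linorder}) vec set)"
proof -
  have sup: "vec.span (std_basis ` L) \<subseteq>
      {x :: ('a, 'n) vec. \<forall>k. k \<notin> std_index ` L \<longrightarrow> x $ k = 0}" for L
    by (rule vec.span_minimal[OF _ subspace_substandard_cart])
      (auto simp: std_basis_axis axis_def)
  have disj: "std_index ` I \<inter> std_index ` K = ({} :: 'n set)"
    using assms inj_on_image_Int[OF inj_on_std_index[where 'n = 'n], of I K] by simp
  have "x = 0" if "x \<in> vec.span (std_basis ` I)" "x \<in> vec.span (std_basis ` K)"
    for x :: "('a, 'n) vec"
    using that sup[of I] sup[of K] disj unfolding vec_eq_iff zero_index by blast
  then show ?thesis by (auto simp: vec.span_zero)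
qed

text \<open>
  In the frame of the preceding lemma, \<open>U\<close> is spanned by the images under \<open>A\<close> of the last \<open>i\<close> basis
  vectors and \<open>U'\<close> by those of the first \<open>j\<close>. The assumption on the dimensions says \<open>i + j = N\<close>,
  where \<open>N\<close> is the dimension of the whole space, so the two spanning sets partition a basis.
\<close>

lemma opposite_members_complementary:
  fixes f f' :: "('a::field, 'n::{finite,linorder}) vec set set"
  assumes "opposite f f'" "U \<in> f" "U' \<in> f'" "vec.dim U + vec.dim U' = CARD('n)"
  shows "U \<inter> U' = {0}" "vec.span (U \<union> U') = UNIV"
proof -
  let ?E = "std_basis :: nat \<Rightarrow> ('a, 'n) vec" and ?N = "CARD('n)"
  obtain M M' where "U \<in> M" "U' \<in> M'" "opposite_maximal M M'"
    using assms unfolding opposite_def by blast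
  from opposite_maximal_frame[OF this(3)] obtain A W :: "('a, 'n) mat" where A: "invertible A"
    and W: "\<forall>i\<in>{1..?N}. W *v ?E i = ?E (?N + 1 - i)"
    and M: "M = (\<lambda>i. (*v) A ` (*v) W ` std_subspace i) ` {1..<?N}"
    and M': "M' = (\<lambda>i. (*v) A ` std_subspace i) ` {1..<?N}"
    .
  obtain i j where i: "i \<in> {1..<?N}" "U = (*v) A ` (*v) W ` std_subspace i"
    and j: "j \<in> {1..<?N}" "U' = (*v) A ` std_subspace j"
    using \<open>U \<in> M\<close> \<open>U' \<in> M'\<close> M M' by auto
  \<comment> \<open>Reversal turns the first \<open>i\<close> basis vectors into the last \<open>i\<close>.\<close>
  have "(*v) W ` ?E ` {1..i} = ?E ` (\<lambda>k. ?N + 1 - k) ` {1..i}"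
    using W i(1) by (auto simp: image_image intro!: image_cong)
  also have "(\<lambda>k. ?N + 1 - k) ` {1..i} = {?N + 1 - i..?N}"
  proof (rule equalityI; rule subsetI)
    fix k assume "k \<in> {?N + 1 - i..?N}"
    then have "k = ?N + 1 - (?N + 1 - k)" "?N + 1 - k \<in> {1..i}" using i(1) by auto
    then show "k \<in> (\<lambda>k. ?N + 1 - k) ` {1..i}" by (rule image_eqI)
  qed auto
  finally have U: "U = (*v) A ` vec.span (?E ` {?N + 1 - i..?N})"
    unfolding i(2) by (simp flip: vec.span_image)
  have "vec.dim U = i"
    unfolding U dim_image_invertible[OF A] using i(1) by (subst dim_span_std_basis) auto
  moreover have "vec.dim U' = j"
    unfolding j(2) dim_image_invertible[OF A] using j(1) by (subst dim_span_std_basis) auto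
  ultimately have ij: "?N + 1 - i = j + 1" using assms(4) i(1) j(1) by auto
  have "vec.span (?E ` {j + 1..?N}) \<inter> std_subspace j = {0}"
    using j(1) by (intro span_std_basis_disjoint) auto
  then have "U \<inter> U' = (*v) A ` {0}"
    unfolding U j(2) ij by (metis image_Int invertible_matrix_inj[OF A])
  then show "U \<inter> U' = {0}" by simp
  have "UNIV = (*v) A ` vec.span (?E ` {1..?N})"
    unfolding std_basis_cart_basis span_cart_basis using invertible_matrix_surj[OF A] by simp
  also have "{1..?N} = {j + 1..?N} \<union> {1..j}" using j(1) by auto
  also have "(*v) A ` vec.span (?E ` ({j + 1..?N} \<union> {1..j})) \<subseteq> vec.span (U \<union> U')"
    unfolding U j(2) ij vec.span_image[symmetric] image_Un
    by (intro vec.span_mono) (auto intro: vec.span_base)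
  finally show "vec.span (U \<union> U') = UNIV" by auto
qed

section \<open>Flags through a point or inside a hyperplane\<close>

theorem theorem3p8:
  fixes m n q v :: nat and J :: "nat set"
    and C :: "('a::{field,finite} ^ 'n::{finite,linorder}) set set set"
  assumes "m \<ge> 2" and "n = 2 * m - 1"
    and "CARD('a) = q" and "CARD('n) = n + 1"
    and "J \<subseteq> {1..n}" and "m \<in> J" and "J = opposite_type n J"
    and "(\<exists>P\<in>subspaces_of_dim 1.
            C = {f \<in> flags_of_type J. \<exists>U\<in>f. vec.dim U = m \<and> P \<subseteq> U}) \<or>
         (\<exists>H\<in>subspaces_of_dim n.
            C = {f \<in> flags_of_type J. \<exists>U\<in>f. vec.dim U = m \<and> U \<subseteq> H})"
    and "v = card (flags_of_type J :: ('a, 'n) vec set set set)"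
  shows "EKR_set J C \<and> real (card C) = real v / (1 + real q ^ ((n + 1) div 2))"
proof -
  have N: "CARD('n) = 2 * m" "n = CARD('n) - 1" using assms(1,2,4) by auto
  have not_opp: "\<not> opposite f f'" if ff: "f \<in> C" "f' \<in> C" for f f'
  proof
    assume opp: "opposite f f'"
    from assms(8) show False
    proof (elim disjE bexE)
      fix P :: "('a, 'n) vec set"
      assume P: "P \<in> subspaces_of_dim 1"
        and C: "C = {f \<in> flags_of_type J. \<exists>U\<in>f. vec.dim U = m \<and> P \<subseteq> U}"
      obtain U U' where "U \<in> f" "U' \<in> f'" "vec.dim U = m" "vec.dim U' = m" "P \<subseteq> U \<inter> U'"
        using ff C by auto
      then have "P \<subseteq> {0}"
        using opposite_members_complementary(1)[OF opp, of U U'] N by simp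
      then show False
        using P vec.dim_eq_0[of P] by (simp add: subspaces_of_dim_def)
    next
      fix H :: "('a, 'n) vec set"
      assume H: "H \<in> subspaces_of_dim n"
        and C: "C = {f \<in> flags_of_type J. \<exists>U\<in>f. vec.dim U = m \<and> U \<subseteq> H}"
      obtain U U' where U: "U \<in> f" "U' \<in> f'" "vec.dim U = m" "vec.dim U' = m" "U \<union> U' \<subseteq> H"
        using ff C by auto
      have "vec.span (U \<union> U') \<subseteq> H"
        using U(5) H by (intro vec.span_minimal) (auto simp: subspaces_of_dim_def)
      then have "H = UNIV"
        using opposite_members_complementary(2)[OF opp, of U U'] N U by auto
      then have "vec.dim H = CARD('n)" by (simp only: vec_dim_card)
      then show False using H assms(4) by (simp add: subspaces_of_dim_def)
    qed
  qed
  have "C \<subseteq> flags_of_type J" using assms(8) by auto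
  then have "EKR_set J C"
    using not_opp assms(7) N by (auto simp: EKR_set_def)
  have "(q ^ (2 * m) - 1) * card C = (q ^ m - 1) * v"
    using assms(8)
  proof (elim disjE bexE)
    fix P :: "('a, 'n) vec set"
    assume "P \<in> subspaces_of_dim 1"
      and "C = {f \<in> flags_of_type J. \<exists>U\<in>f. vec.dim U = m \<and> P \<subseteq> U}"
    then show ?thesis
      using card_flags_through_point[OF _ assms(6), of P] N assms(3,9) by simp
  next
    fix H :: "('a, 'n) vec set"
    assume "H \<in> subspaces_of_dim n"
      and "C = {f \<in> flags_of_type J. \<exists>U\<in>f. vec.dim U = m \<and> U \<subseteq> H}"
    then show ?thesis
      using card_flags_in_hyperplane[OF _ assms(6), of H] N assms(3,9) by simp
  qed
  moreover have "q > 1"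
    using card_mono[of UNIV "{0, 1 :: 'a}"] assms(3) by simp
  then have qm: "q ^ m > 1" using assms(1) by (intro one_less_power) auto
  have "q ^ (2 * m) - 1 = (q ^ m - 1) * (1 + q ^ m)"
    unfolding mult_2 power_add using qm by (simp add: algebra_simps diff_mult_distrib)
  ultimately have "(q ^ m - 1) * ((1 + q ^ m) * card C) = (q ^ m - 1) * v"
    by (simp only: mult.assoc)
  then have "(1 + q ^ m) * card C = v" using qm by simp
  then have "(1 + real q ^ m) * real (card C) = real v"
    by (metis of_nat_1 of_nat_add of_nat_mult of_nat_power)
  moreover have "1 + real q ^ m \<noteq> 0"
    by (metis add_pos_nonneg less_irrefl of_nat_0_le_iff zero_le_power zero_less_one)
  moreover have "(n + 1) div 2 = m" using assms(1,2) by simp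
  ultimately have "real (card C) = real v / (1 + real q ^ ((n + 1) div 2))"
    using \<open>(n + 1) div 2 = m\<close> by (simp add: field_simps)
  with \<open>EKR_set J C\<close> show ?thesis by simp
qed

end
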